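(* Let $(X,d)$ be a metric space and let $E,F\subseteq X$ be non-empty. Then \[ \min\{\dim_{\mathrm L}E,\ \dim_{\mathrm L}F\}\leq \dim_{\mathrm L}(E\cup F)\leq \max\{\dim_{\mathrm L}E,\ \dim_{\mathrm A}F\}. \] Moreover, if $\inf_{x\in E,\,y\in F}d(x,y)>0$, then \[ \dim_{\mathrm L}(E\cup F)=\min\{\dim_{\mathrm L}E,\ \dim_{\mathrm L}F\}. \]
   Context: For a non-empty subset $F$ of a metric space and $r>0$, $N_r(F)$ denotes the smallest number of open sets of diameter at most $r$ needed to cover $F$ (possibly $\infty$). $B(x,R)$ is the closed ball of centre $x$ and radius $R$. The Assouad dimension is \[ \dim_{\mathrm A}F=\inf\Big\{\alpha:\ \exists\, C,\rho>0 \text{ such that for all } 0<r<R\leq\rho,\ \sup_{x\in F}N_r(B(x,R)\cap F)\leq C (R/r)^{\alpha}\Big\}, \] and the lower dimension is \[ \dim_{\mathrm L}F=\sup\Big\{\alpha:\ \exists\, C,\rho>0 \text{ such that for all } 0<r<R\leq\rho,\ \inf_{x\in F}N_r(B(x,R)\cap F)\geq C (R/r)^{\alpha}\Big\}. \] Both take values in $[0,\infty]$. *)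

theory Defs
  imports "HOL-Analysis.Analysis"
begin

text \<open>The covering sets are open in the ambient space, not merely relatively open in \<open>F\<close>.
  Boundedness is required explicitly because \<^const>\<open>diameter\<close> is unspecified for unbounded sets.
  If there is no finite cover, the infimum is \<open>Inf {} = \<infinity>\<close>.\<close>

definition covering_number :: "real \<Rightarrow> 'a::metric_space set \<Rightarrow> enat" where
  "covering_number r F = Inf {enat (card \<U>) | \<U>.
     finite \<U> \<and> (\<forall>U\<in>\<U>. open U \<and> bounded U \<and> diameter U \<le> r) \<and> F \<subseteq> \<Union>\<U>}"

text \<open>The exponent \<open>\<alpha>\<close> ranges over all reals; for non-empty \<open>F\<close> both dimensions below are
  nevertheless non-negative, since every covering number involved is at least 1.
  An empty infimum gives Assouad dimension \<open>\<infinity>\<close>.\<close>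

definition assouad_dim :: "'a::metric_space set \<Rightarrow> ereal" where
  "assouad_dim F = Inf {ereal \<alpha> | \<alpha>. \<exists>C>0. \<exists>\<rho>>0. \<forall>r R. 0 < r \<and> r < R \<and> R \<le> \<rho> \<longrightarrow>
     ereal_of_enat (SUP x\<in>F. covering_number r (cball x R \<inter> F)) \<le> ereal (C * (R / r) powr \<alpha>)}"

definition lower_dim :: "'a::metric_space set \<Rightarrow> ereal" where
  "lower_dim F = Sup {ereal \<alpha> | \<alpha>. \<exists>C>0. \<exists>\<rho>>0. \<forall>r R. 0 < r \<and> r < R \<and> R \<le> \<rho> \<longrightarrow>
     ereal_of_enat (INF x\<in>F. covering_number r (cball x R \<inter> F)) \<ge> ereal (C * (R / r) powr \<alpha>)}"

end

theory Submission
  imports Defs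
begin

text \<open>Call \<open>\<alpha>\<close> a lower exponent of a non-empty set if it is admissible in the definition of its lower
  dimension, and an Assouad exponent if it is admissible in the definition of its Assouad dimension.
  Everything reduces to comparing exponents, and the geometry of coverings enters only through
  \<^const>\<open>covering_number\<close> being monotone, subadditive, 0 on the empty set and at least 1 on any
  other set.

  \<^item> Balls of \<open>E \<union> F\<close> are centred in \<open>E\<close> or in \<open>F\<close>, so by monotonicity a common lower exponent of
    \<open>E\<close> and \<open>F\<close> is one of \<open>E \<union> F\<close>. The lower exponents are closed downwards, so every real below
    both dimensions is a common one (\<open>min_lower_dim_le_Un\<close>).

  \<^item> Let \<open>\<alpha>\<close> be a lower exponent of \<open>E \<union> F\<close> and \<open>\<beta> < \<alpha>\<close> an Assouad exponent of \<open>F\<close>. Inside a ball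
    centred in \<open>E\<close>, the part of \<open>F\<close> lies in a ball of twice the radius centred in \<open>F\<close>, so it
    contributes at most a multiple of \<open>(R/r)\<^sup>\<beta>\<close> to a covering number that is at least a multiple of
    \<open>(R/r)\<^sup>\<alpha>\<close>. When \<open>R/r\<close> is large, subadditivity leaves half of the lower bound to \<open>E\<close>; when
    \<open>R/r\<close> is bounded, the trivial bound 1 is enough. So \<open>\<alpha>\<close> is a lower exponent of \<open>E\<close>
    (\<open>lower_exponent_Un_minus_assouad\<close>), which is the second inequality.

  \<^item> If \<open>E\<close> and \<open>F\<close> have positive distance, small balls centred in one of them do not meet the
    other, so small scales see \<open>E \<union> F\<close> near \<open>E\<close> simply as \<open>E\<close>
    (\<open>lower_exponent_Un_separated\<close>).\<close>

section \<open>Covering numbers\<close>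

lemma covering_number_le_card:
  assumes "finite \<U>" "\<And>U. U \<in> \<U> \<Longrightarrow> open U \<and> bounded U \<and> diameter U \<le> r" "F \<subseteq> \<Union>\<U>"
  shows "covering_number r F \<le> enat (card \<U>)"
  unfolding covering_number_def using assms by (intro Inf_lower) blast

lemma covering_number_attained:
  assumes "covering_number r F \<noteq> \<infinity>"
  obtains \<U> where "finite \<U>" "\<And>U. U \<in> \<U> \<Longrightarrow> open U \<and> bounded U \<and> diameter U \<le> r" "F \<subseteq> \<Union>\<U>"
    "covering_number r F = enat (card \<U>)"
proof -
  let ?S = "{enat (card \<U>) | \<U>.
     finite \<U> \<and> (\<forall>U\<in>\<U>. open U \<and> bounded U \<and> diameter U \<le> r) \<and> F \<subseteq> \<Union>\<U>}"
  have "?S \<noteq> {}"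
    using assms unfolding covering_number_def by (metis (no_types, lifting) Inf_empty top_enat_def)
  then have "Inf ?S \<in> ?S"
    by (metis (no_types, lifting) ex_in_conv wellorder_InfI)
  then show ?thesis
    using that unfolding covering_number_def by blast
qed

lemma covering_number_mono:
  assumes "A \<subseteq> B"
  shows "covering_number r A \<le> covering_number r B"
  unfolding covering_number_def using assms by (intro Inf_superset_mono) blast

lemma covering_number_empty [simp]: "covering_number r {} = 0"
  using covering_number_le_card[of "{}" r "{}"] by (simp add: zero_enat_def[symmetric])

lemma one_le_covering_number:
  assumes "F \<noteq> {}"
  shows "1 \<le> covering_number r F"
proof (cases "covering_number r F = \<infinity>")
  case False
  then obtain \<U> where "finite \<U>" "F \<subseteq> \<Union>\<U>" "covering_number r F = enat (card \<U>)"
    by (metis covering_number_attained)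
  moreover from this assms have "card \<U> \<noteq> 0"
    by auto
  ultimately show ?thesis
    by (simp add: one_enat_def Suc_le_eq card_gt_0_iff)
qed simp

lemma covering_number_Un_le:
  "covering_number r (A \<union> B) \<le> covering_number r A + covering_number r B"
proof (cases "covering_number r A = \<infinity> \<or> covering_number r B = \<infinity>")
  case False
  then obtain \<U> \<V> where
    U: "finite \<U>" "\<And>U. U \<in> \<U> \<Longrightarrow> open U \<and> bounded U \<and> diameter U \<le> r" "A \<subseteq> \<Union>\<U>"
       "covering_number r A = enat (card \<U>)" and
    V: "finite \<V>" "\<And>U. U \<in> \<V> \<Longrightarrow> open U \<and> bounded U \<and> diameter U \<le> r" "B \<subseteq> \<Union>\<V>"
       "covering_number r B = enat (card \<V>)"
    by (metis covering_number_attained)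
  have "covering_number r (A \<union> B) \<le> enat (card (\<U> \<union> \<V>))"
    using U V by (intro covering_number_le_card) auto
  also have "\<dots> \<le> enat (card \<U> + card \<V>)"
    by (simp add: card_Un_le)
  finally show ?thesis
    using U V by simp
qed auto

section \<open>Exponents\<close>

definition lower_exponent :: "'a::metric_space set \<Rightarrow> real \<Rightarrow> bool" where
  "lower_exponent F \<alpha> \<longleftrightarrow> (\<exists>C>0. \<exists>\<rho>>0. \<forall>r R. 0 < r \<and> r < R \<and> R \<le> \<rho> \<longrightarrow>
     (\<forall>x\<in>F. ereal (C * (R / r) powr \<alpha>) \<le> ereal_of_enat (covering_number r (cball x R \<inter> F))))"

definition assouad_exponent :: "'a::metric_space set \<Rightarrow> real \<Rightarrow> bool" where
  "assouad_exponent F \<alpha> \<longleftrightarrow> (\<exists>C>0. \<exists>\<rho>>0. \<forall>r R. 0 < r \<and> r < R \<and> R \<le> \<rho> \<longrightarrow>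
     (\<forall>x\<in>F. ereal_of_enat (covering_number r (cball x R \<inter> F)) \<le> ereal (C * (R / r) powr \<alpha>)))"

text \<open>The embedding of \<^typ>\<open>enat\<close> into \<^typ>\<open>ereal\<close> commutes with infima, which are attained
  unless they are the infimum \<open>\<infinity>\<close> of the empty set. For suprema the index set must be non-empty,
  because the supremum of the empty set is 0 in \<^typ>\<open>enat\<close> but \<open>-\<infinity>\<close> in \<^typ>\<open>ereal\<close>.\<close>

lemma le_ereal_of_enat_INF_iff:
  "c \<le> ereal_of_enat (INF x\<in>A. f x) \<longleftrightarrow> (\<forall>x\<in>A. c \<le> ereal_of_enat (f x))"
proof (cases "A = {}")
  case True
  then show ?thesis by (simp add: top_enat_def)
next
  case False
  then have "(INF x\<in>A. f x) \<in> f ` A"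
    by (metis ex_in_conv image_is_empty wellorder_InfI)
  then show ?thesis
    by (metis INF_lower ereal_of_enat_le_iff imageE order_trans)
qed

lemma ereal_of_enat_SUP_le_iff:
  assumes "A \<noteq> {}"
  shows "ereal_of_enat (SUP x\<in>A. f x) \<le> c \<longleftrightarrow> (\<forall>x\<in>A. ereal_of_enat (f x) \<le> c)"
  using assms by (simp add: ereal_of_enat_SUP SUP_le_iff)

lemma lower_dim_eq_Sup_exponents: "lower_dim F = Sup {ereal \<alpha> | \<alpha>. lower_exponent F \<alpha>}"
  unfolding lower_dim_def lower_exponent_def le_ereal_of_enat_INF_iff ..

lemma assouad_dim_eq_Inf_exponents:
  assumes "F \<noteq> {}"
  shows "assouad_dim F = Inf {ereal \<alpha> | \<alpha>. assouad_exponent F \<alpha>}"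
  unfolding assouad_dim_def assouad_exponent_def ereal_of_enat_SUP_le_iff[OF assms] ..

lemma lower_exponent_le_lower_dim: "lower_exponent F \<alpha> \<Longrightarrow> ereal \<alpha> \<le> lower_dim F"
  unfolding lower_dim_eq_Sup_exponents by (intro Sup_upper) blast

lemma lower_dim_le_iff: "lower_dim F \<le> d \<longleftrightarrow> (\<forall>\<alpha>. lower_exponent F \<alpha> \<longrightarrow> ereal \<alpha> \<le> d)"
  unfolding lower_dim_eq_Sup_exponents Sup_le_iff by blast

lemma less_lower_dim_iff: "z < lower_dim F \<longleftrightarrow> (\<exists>\<alpha>. lower_exponent F \<alpha> \<and> z < ereal \<alpha>)"
  unfolding lower_dim_eq_Sup_exponents less_Sup_iff by blast

lemma lower_exponent_antimono:
  assumes "lower_exponent F \<beta>" "\<alpha> \<le> \<beta>"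
  shows "lower_exponent F \<alpha>"
proof -
  obtain C \<rho> where "C > 0" "\<rho> > 0" and
    *: "\<And>r R x. \<lbrakk>0 < r; r < R; R \<le> \<rho>; x \<in> F\<rbrakk> \<Longrightarrow>
      ereal (C * (R / r) powr \<beta>) \<le> ereal_of_enat (covering_number r (cball x R \<inter> F))"
    using assms(1) unfolding lower_exponent_def by blast
  have "ereal (C * (R / r) powr \<alpha>) \<le> ereal_of_enat (covering_number r (cball x R \<inter> F))"
    if "0 < r" "r < R" "R \<le> \<rho>" "x \<in> F" for r R x
  proof -
    have "(R / r) powr \<alpha> \<le> (R / r) powr \<beta>"
      using that assms(2) by (intro powr_mono) auto
    then have "ereal (C * (R / r) powr \<alpha>) \<le> ereal (C * (R / r) powr \<beta>)"
      using \<open>C > 0\<close> by simp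
    also note *[OF that]
    finally show ?thesis .
  qed
  then show ?thesis
    unfolding lower_exponent_def using \<open>C > 0\<close> \<open>\<rho> > 0\<close> by blast
qed

section \<open>The lower bound\<close>

lemma lower_exponent_Un:
  assumes "lower_exponent E \<alpha>" "lower_exponent F \<alpha>"
  shows "lower_exponent (E \<union> F) \<alpha>"
proof -
  obtain C \<rho> where "C > 0" "\<rho> > 0" and
    E: "\<And>r R x. \<lbrakk>0 < r; r < R; R \<le> \<rho>; x \<in> E\<rbrakk> \<Longrightarrow>
      ereal (C * (R / r) powr \<alpha>) \<le> ereal_of_enat (covering_number r (cball x R \<inter> E))"
    using assms(1) unfolding lower_exponent_def by blast
  obtain D \<sigma> where "D > 0" "\<sigma> > 0" and
    F: "\<And>r R x. \<lbrakk>0 < r; r < R; R \<le> \<sigma>; x \<in> F\<rbrakk> \<Longrightarrow>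
      ereal (D * (R / r) powr \<alpha>) \<le> ereal_of_enat (covering_number r (cball x R \<inter> F))"
    using assms(2) unfolding lower_exponent_def by blast
  have "ereal (min C D * (R / r) powr \<alpha>) \<le> ereal_of_enat (covering_number r (cball x R \<inter> (E \<union> F)))"
    if "0 < r" "r < R" "R \<le> min \<rho> \<sigma>" "x \<in> E \<union> F" for r R x
  proof -
    have mono: "ereal_of_enat (covering_number r (cball x R \<inter> G))
        \<le> ereal_of_enat (covering_number r (cball x R \<inter> (E \<union> F)))" if "G \<subseteq> E \<union> F" for G
      using that by (simp, intro covering_number_mono) blast
    have min: "ereal (min C D * (R / r) powr \<alpha>) \<le> ereal (C * (R / r) powr \<alpha>)"
         "ereal (min C D * (R / r) powr \<alpha>) \<le> ereal (D * (R / r) powr \<alpha>)"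
      by (simp_all add: mult_right_mono)
    show ?thesis
    proof (cases "x \<in> E")
      case True
      then show ?thesis
        using that by (intro order_trans[OF min(1) order_trans[OF E mono]]) auto
    next
      case False
      then show ?thesis
        using that by (intro order_trans[OF min(2) order_trans[OF F mono]]) auto
    qed
  qed
  then show ?thesis
    unfolding lower_exponent_def using \<open>C > 0\<close> \<open>\<rho> > 0\<close> \<open>D > 0\<close> \<open>\<sigma> > 0\<close>
    by (intro exI[of _ "min C D"] conjI exI[of _ "min \<rho> \<sigma>"]) auto
qed

lemma min_lower_dim_le_Un: "min (lower_dim E) (lower_dim F) \<le> lower_dim (E \<union> F)"
proof (rule dense_le)
  fix z assume "z < min (lower_dim E) (lower_dim F)"
  then obtain \<alpha> \<beta> where "lower_exponent E \<alpha>" "z < ereal \<alpha>" "lower_exponent F \<beta>" "z < ereal \<beta>"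
    by (auto simp: less_lower_dim_iff)
  then have "lower_exponent (E \<union> F) (min \<alpha> \<beta>)" "z < ereal (min \<alpha> \<beta>)"
    by (auto intro!: lower_exponent_Un elim: lower_exponent_antimono simp: min_def)
  then show "z \<le> lower_dim (E \<union> F)"
    by (meson less_lower_dim_iff less_imp_le)
qed

section \<open>The upper bound\<close>

text \<open>In the definition of the Assouad dimension the centre lies in \<open>F\<close>. Doubling the radius frees
  it: if the ball meets \<open>F\<close> at \<open>y\<close>, move the centre to \<open>y\<close>.\<close>

lemma assouad_exponent_arbitrary_centre:
  assumes "assouad_exponent F \<beta>"
  obtains D \<sigma> where "D > 0" "\<sigma> > 0"
    "\<And>r R x. \<lbrakk>0 < r; r < R; R \<le> \<sigma>\<rbrakk> \<Longrightarrow>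
      ereal_of_enat (covering_number r (cball x R \<inter> F)) \<le> ereal (D * (R / r) powr \<beta>)"
proof -
  obtain D \<sigma> where "D > 0" "\<sigma> > 0" and
    F: "\<And>r R x. \<lbrakk>0 < r; r < R; R \<le> \<sigma>; x \<in> F\<rbrakk> \<Longrightarrow>
      ereal_of_enat (covering_number r (cball x R \<inter> F)) \<le> ereal (D * (R / r) powr \<beta>)"
    using assms unfolding assouad_exponent_def by blast
  have "ereal_of_enat (covering_number r (cball x R \<inter> F)) \<le> ereal (D * 2 powr \<beta> * (R / r) powr \<beta>)"
    if "0 < r" "r < R" "R \<le> \<sigma> / 2" for r R x
  proof (cases "cball x R \<inter> F = {}")
    case True
    then show ?thesis
      using \<open>D > 0\<close> by simp
  next
    case False
    then obtain y where y: "y \<in> F" "dist x y \<le> R"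
      by auto
    have "cball x R \<subseteq> cball y (2 * R)"
      using y(2) by (auto simp: dist_commute) (smt (verit) dist_commute dist_triangle)
    then have "ereal_of_enat (covering_number r (cball x R \<inter> F))
        \<le> ereal_of_enat (covering_number r (cball y (2 * R) \<inter> F))"
      by (simp, intro covering_number_mono) blast
    also have "\<dots> \<le> ereal (D * (2 * R / r) powr \<beta>)"
      using that y by (intro F) auto
    also have "D * (2 * R / r) powr \<beta> = D * 2 powr \<beta> * (R / r) powr \<beta>"
      using that powr_mult[of 2 "R / r" \<beta>] by simp
    finally show ?thesis .
  qed
  then show ?thesis
    using that[of "D * 2 powr \<beta>" "\<sigma> / 2"] \<open>D > 0\<close> \<open>\<sigma> > 0\<close> by simp
qed

text \<open>If \<open>D t\<^sup>\<beta>\<close> is not yet dominated by \<open>c t\<^sup>\<alpha>\<close>, then \<open>t\<^bsup>\<alpha> - \<beta>\<^esup> < D / c\<close>, and raising this to the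
  power \<open>\<alpha> / (\<alpha> - \<beta>)\<close> bounds \<open>t\<^sup>\<alpha>\<close>.\<close>

lemma powr_dominated_or_bounded:
  fixes \<alpha> \<beta> c D :: real
  assumes "\<beta> < \<alpha>" "c > 0"
  obtains M where "M > 0" "\<And>t. t > 1 \<Longrightarrow> D * t powr \<beta> \<le> c * t powr \<alpha> \<or> t powr \<alpha> \<le> M"
proof
  define M where "M = max 1 ((D / c) powr (\<alpha> / (\<alpha> - \<beta>)))"
  show "M > 0"
    unfolding M_def by simp
  show "D * t powr \<beta> \<le> c * t powr \<alpha> \<or> t powr \<alpha> \<le> M" if "t > 1" for t
  proof (rule disjCI)
    assume "\<not> t powr \<alpha> \<le> M"
    then have 1: "1 < t powr \<alpha>" and 2: "(D / c) powr (\<alpha> / (\<alpha> - \<beta>)) < t powr \<alpha>"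
      unfolding M_def by simp_all
    from 1 \<open>t > 1\<close> have "\<alpha> > 0"
      using powr_mono[of \<alpha> 0 t] by (cases "\<alpha> > 0") auto
    have "D / c \<le> t powr (\<alpha> - \<beta>)"
    proof (rule ccontr)
      assume "\<not> D / c \<le> t powr (\<alpha> - \<beta>)"
      then have "(t powr (\<alpha> - \<beta>)) powr (\<alpha> / (\<alpha> - \<beta>)) \<le> (D / c) powr (\<alpha> / (\<alpha> - \<beta>))"
        using \<open>\<alpha> > 0\<close> assms by (intro powr_mono2) auto
      then show False
        using 2 assms by (simp add: powr_powr)
    qed
    then have "D \<le> c * t powr (\<alpha> - \<beta>)"
      using assms by (simp add: field_simps)
    then have "D * t powr \<beta> \<le> c * t powr (\<alpha> - \<beta>) * t powr \<beta>"
      by (intro mult_right_mono) auto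
    then show "D * t powr \<beta> \<le> c * t powr \<alpha>"
      by (simp add: mult.assoc flip: powr_add)
  qed
qed

text \<open>A set with a smaller Assouad exponent is too thin to supply the growth rate \<open>\<alpha>\<close> of the
  covering numbers of \<open>E \<union> F\<close>; around points of \<open>E\<close>, that growth must come from \<open>E\<close>.\<close>

lemma lower_exponent_Un_minus_assouad:
  assumes "lower_exponent (E \<union> F) \<alpha>" "assouad_exponent F \<beta>" "\<beta> < \<alpha>"
  shows "lower_exponent E \<alpha>"
proof -
  obtain C \<rho> where "C > 0" "\<rho> > 0" and
    EF: "\<And>r R x. \<lbrakk>0 < r; r < R; R \<le> \<rho>; x \<in> E \<union> F\<rbrakk> \<Longrightarrow>
      ereal (C * (R / r) powr \<alpha>) \<le> ereal_of_enat (covering_number r (cball x R \<inter> (E \<union> F)))"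
    using assms(1) unfolding lower_exponent_def by blast
  obtain D \<sigma> where "D > 0" "\<sigma> > 0" and
    F: "\<And>r R x. \<lbrakk>0 < r; r < R; R \<le> \<sigma>\<rbrakk> \<Longrightarrow>
      ereal_of_enat (covering_number r (cball x R \<inter> F)) \<le> ereal (D * (R / r) powr \<beta>)"
    using assouad_exponent_arbitrary_centre[OF assms(2)] by metis
  obtain M where "M > 0" and
    M: "\<And>t. t > 1 \<Longrightarrow> D * t powr \<beta> \<le> C / 2 * t powr \<alpha> \<or> t powr \<alpha> \<le> M"
    using powr_dominated_or_bounded[OF assms(3), of "C / 2" D] \<open>C > 0\<close> by auto
  \<comment> \<open>Half of \<open>C\<close> survives at scales where \<open>F\<close> is negligible; \<open>1 / M\<close> is for the other scales,
    where the covering number is merely known to be at least 1.\<close>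
  define C' where "C' = min (C / 2) (1 / M)"
  have "ereal (C' * (R / r) powr \<alpha>) \<le> ereal_of_enat (covering_number r (cball x R \<inter> E))"
    if "0 < r" "r < R" "R \<le> min \<rho> \<sigma>" "x \<in> E" for r R x
  proof (cases "covering_number r (cball x R \<inter> E)")
    case (enat n)
    define t where "t = R / r"
    have "t > 1"
      using that by (simp add: t_def)
    have "ereal_of_enat (covering_number r (cball x R \<inter> F)) \<le> ereal (D * t powr \<beta>)"
      unfolding t_def using that by (intro F) auto
    moreover from this obtain m where m: "covering_number r (cball x R \<inter> F) = enat m"
      by (cases "covering_number r (cball x R \<inter> F)") auto
    ultimately have small: "real m \<le> D * t powr \<beta>"
      by simp
    have "ereal (C * t powr \<alpha>) \<le> ereal_of_enat (covering_number r (cball x R \<inter> (E \<union> F)))"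
      unfolding t_def using that by (intro EF) auto
    also have "\<dots> \<le> ereal_of_enat (enat n + enat m)"
      using covering_number_Un_le[of r "cball x R \<inter> E" "cball x R \<inter> F"]
      by (simp only: Int_Un_distrib enat m ereal_of_enat_le_iff)
    finally have large: "C * t powr \<alpha> \<le> real n + real m"
      by simp
    have "cball x R \<inter> E \<noteq> {}"
      using \<open>x \<in> E\<close> \<open>0 < r\<close> \<open>r < R\<close> by (metis IntI centre_in_cball empty_iff less_imp_le order_trans)
    from one_le_covering_number[OF this, of r] have "real n \<ge> 1"
      by (simp add: enat one_enat_def)
    have "C' * t powr \<alpha> \<le> real n"
      using M[OF \<open>t > 1\<close>]
    proof
      assume "D * t powr \<beta> \<le> C / 2 * t powr \<alpha>"
      then have "C / 2 * t powr \<alpha> \<le> real n"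
        using large small by simp
      moreover have "C' * t powr \<alpha> \<le> C / 2 * t powr \<alpha>"
        unfolding C'_def by (intro mult_right_mono) auto
      ultimately show ?thesis
        by linarith
    next
      assume "t powr \<alpha> \<le> M"
      then have "1 / M * t powr \<alpha> \<le> 1"
        using \<open>M > 0\<close> by simp
      moreover have "C' * t powr \<alpha> \<le> 1 / M * t powr \<alpha>"
        unfolding C'_def by (intro mult_right_mono) auto
      ultimately show ?thesis
        using \<open>real n \<ge> 1\<close> by linarith
    qed
    then show ?thesis
      by (simp add: enat t_def)
  qed simp
  moreover have "C' > 0"
    using \<open>C > 0\<close> \<open>M > 0\<close> by (simp add: C'_def)
  ultimately show ?thesis
    unfolding lower_exponent_def using \<open>\<rho> > 0\<close> \<open>\<sigma> > 0\<close>
    by (intro exI[of _ C'] conjI exI[of _ "min \<rho> \<sigma>"]) auto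
qed

lemma lower_dim_Un_le_max:
  assumes "F \<noteq> {}"
  shows "lower_dim (E \<union> F) \<le> max (lower_dim E) (assouad_dim F)"
  unfolding lower_dim_le_iff
proof (intro allI impI)
  fix \<alpha> assume \<alpha>: "lower_exponent (E \<union> F) \<alpha>"
  show "ereal \<alpha> \<le> max (lower_dim E) (assouad_dim F)"
  proof (cases "assouad_dim F < ereal \<alpha>")
    case True
    then obtain \<beta> where "assouad_exponent F \<beta>" "\<beta> < \<alpha>"
      by (auto simp: assouad_dim_eq_Inf_exponents[OF assms] Inf_less_iff)
    then have "lower_exponent E \<alpha>"
      using lower_exponent_Un_minus_assouad \<alpha> by blast
    then show ?thesis
      by (simp add: lower_exponent_le_lower_dim le_max_iff_disj)
  next
    case False
    then show ?thesis
      by (simp add: le_max_iff_disj not_less)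
  qed
qed

section \<open>Separated sets\<close>

lemma lower_exponent_Un_separated:
  assumes "lower_exponent (E \<union> F) \<alpha>" "\<delta> > 0" "\<And>x y. x \<in> E \<Longrightarrow> y \<in> F \<Longrightarrow> \<delta> \<le> dist x y"
  shows "lower_exponent E \<alpha>"
proof -
  obtain C \<rho> where "C > 0" "\<rho> > 0" and
    EF: "\<And>r R x. \<lbrakk>0 < r; r < R; R \<le> \<rho>; x \<in> E \<union> F\<rbrakk> \<Longrightarrow>
      ereal (C * (R / r) powr \<alpha>) \<le> ereal_of_enat (covering_number r (cball x R \<inter> (E \<union> F)))"
    using assms(1) unfolding lower_exponent_def by blast
  \<comment> \<open>Balls are closed and \<open>\<delta>\<close> may be attained, so radii must stay strictly below \<open>\<delta>\<close>.\<close>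
  have "ereal (C * (R / r) powr \<alpha>) \<le> ereal_of_enat (covering_number r (cball x R \<inter> E))"
    if "0 < r" "r < R" "R \<le> min \<rho> (\<delta> / 2)" "x \<in> E" for r R x
  proof -
    have "cball x R \<inter> (E \<union> F) = cball x R \<inter> E"
      using that assms(2) assms(3)[of x] by force
    then show ?thesis
      using EF[of r R x] that by simp
  qed
  then show ?thesis
    unfolding lower_exponent_def using \<open>C > 0\<close> \<open>\<rho> > 0\<close> \<open>\<delta> > 0\<close>
    by (intro exI[of _ C] conjI exI[of _ "min \<rho> (\<delta> / 2)"]) auto
qed

lemma lower_dim_Un_le_separated:
  assumes "\<delta> > 0" "\<And>x y. x \<in> E \<Longrightarrow> y \<in> F \<Longrightarrow> \<delta> \<le> dist x y"
  shows "lower_dim (E \<union> F) \<le> lower_dim E"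
  using lower_exponent_Un_separated[OF _ assms] lower_exponent_le_lower_dim
  unfolding lower_dim_le_iff by blast

section \<open>Lower dimension of a union\<close>

theorem theorem2p2:
  fixes E F :: "'a::metric_space set"
  assumes "E \<noteq> {}" and "F \<noteq> {}"
  shows "min (lower_dim E) (lower_dim F) \<le> lower_dim (E \<union> F)
       \<and> lower_dim (E \<union> F) \<le> max (lower_dim E) (assouad_dim F)
       \<and> ((INF (x, y)\<in>E \<times> F. dist x y) > 0 \<longrightarrow>
            lower_dim (E \<union> F) = min (lower_dim E) (lower_dim F))"
proof (intro conjI impI)
  show "min (lower_dim E) (lower_dim F) \<le> lower_dim (E \<union> F)"
    by (rule min_lower_dim_le_Un)
  show "lower_dim (E \<union> F) \<le> max (lower_dim E) (assouad_dim F)"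
    using assms(2) by (rule lower_dim_Un_le_max)
next
  let ?\<delta> = "INF (x, y)\<in>E \<times> F. dist x y"
  assume "?\<delta> > 0"
  have "bdd_below ((\<lambda>(x, y). dist x y) ` (E \<times> F))"
    by (intro bdd_belowI[of _ 0]) auto
  then have \<delta>: "?\<delta> \<le> dist x y" if "x \<in> E" "y \<in> F" for x y
    using cINF_lower[of "\<lambda>(x, y). dist x y" "E \<times> F" "(x, y)"] that by simp
  have "lower_dim (E \<union> F) \<le> lower_dim E"
    using \<open>?\<delta> > 0\<close> \<delta> by (rule lower_dim_Un_le_separated)
  moreover have "lower_dim (F \<union> E) \<le> lower_dim F"
    using \<open>?\<delta> > 0\<close>
  proof (rule lower_dim_Un_le_separated)
    show "?\<delta> \<le> dist y x" if "y \<in> F" "x \<in> E" for y x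
      using \<delta>[OF that(2,1)] by (simp add: dist_commute)
  qed
  ultimately show "lower_dim (E \<union> F) = min (lower_dim E) (lower_dim F)"
    using min_lower_dim_le_Un[of E F] by (simp add: Un_commute antisym)
qed

end
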